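(* Let $d_1,d_2>0$ and $\theta\in\mathbb{R}$, and let $f,g$ be real-valued continuous functions on $[0,\infty)\times[0,\infty)$ satisfying hypotheses [H1], [H2], [H3], [H4] listed in the context, with the associated constants $u^\ast,v^\ast,u_1,u_2,v_1,v_2>0$ and $\bar u>\underline{u}>0$, $\bar v>\underline{v}>0$. Let $\mathbf{e}_-$ and $\mathbf{e}_+$ each be one of the points $(0,0)$, $(u_1,0)$, $(0,v_2)$, $(u^\ast,v^\ast)$. Suppose that $(u(x),v(x))$, with $u(x)>0$ and $v(x)>0$ for all $x\in\mathbb{R}$, is a positive solution of the boundary value problem $$ \begin{cases} d_1\,u_{xx}+\theta\,u_{x}+u\,f(u,v)=0, & x\in\mathbb{R},\\ d_2\,v_{xx}+\theta\,v_{x}+v\,g(u,v)=0, & x\in\mathbb{R},\\ (u,v)(-\infty)=\mathbf{e}_{-},\quad (u,v)(+\infty)=\mathbf{e}_{+}. \end{cases} $$ Then for any $\alpha,\beta>0$, the function $p(x)=\alpha\,u(x)+\beta\,v(x)$ satisfies $$ \underline{p}\le p(x)\le \bar p,\qquad x\in\mathbb{R}, $$ where $$ \bar p=\max(\alpha\,\bar u,\beta\,\bar v)\,\frac{\max(d_1,d_2)}{\min(d_1,d_2)},\qquad \underline{p}=\min(\alpha\,\underline{u},\beta\,\underline{v})\,\frac{\min(d_1,d_2)}{\max(d_1,d_2)}\,\chi, $$ and $\chi=1$ if both $\mathbf{e}_-\neq(0,0)$ and $\mathbf{e}_+\neq(0,0)$, while $\chi=0$ if $\mathbf{e}_-=(0,0)$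 or $\mathbf{e}_+=(0,0)$.
   Context: The values $(u,v)(\pm\infty)$ denote the limits of $(u(x),v(x))$ as $x\to\pm\infty$; solutions are classical (twice differentiable functions on $\mathbb{R}$). The hypotheses on $f$ and $g$ are: [H1] The unique solution of $f(u,v)=g(u,v)=0$ with $u,v>0$ is $(u,v)=(u^\ast,v^\ast)$. [H2] The unique solution of $f(u,0)=0$, $u>0$, is $u=u_1>0$; the unique solution of $f(0,v)=0$, $v>0$, is $v=v_1>0$; the unique solution of $g(u,0)=0$, $u>0$, is $u=u_2>0$; the unique solution of $g(0,v)=0$, $v>0$, is $v=v_2>0$. [H3] $f(u,v)<0$ and $g(u,v)<0$ when $u,v>0$ are sufficiently large; $f(u,v)>0$ and $g(u,v)>0$ when $u,v>0$ are sufficiently small. [H4] There are constants $\bar u>\underline{u}>0$ and $\bar v>\underline{v}>0$ such that the two curves $\mathcal{C}_f=\{(u,v): f(u,v)=0,\ u,v\ge0\}$ and $\mathcal{C}_g=\{(u,v): g(u,v)=0,\ u,v\ge0\}$ lie completely within the region $\mathcal{R}$ enclosed by the $u$-axis, the $v$-axis, the line $\bar{\mathcal{L}}=\{(u,v): \frac{u}{\bar u}+\frac{v}{\bar v}=1,\ u,v\ge0\}$ and the line $\underline{\mathcal{L}}=\{(u,v): \frac{u}{\underline{u}}+\frac{v}{\underline{v}}=1,\ u,v\ge0\}$; that is, $\mathcal{R}=\{(u,v): u,v\ge0,\ \frac{u}{\underline{u}}+\frac{v}{\underline{v}}\ge1,\ \frac{u}{\bar u}+\frac{v}{\bar v}\le1\}$.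 *)

theory Defs
  imports "HOL-Analysis.Analysis"
begin

text \<open>
  The nonlinearities are total functions on \<open>real \<times> real\<close>; every condition below only involves
  their values on the closed quadrant, so the values elsewhere are irrelevant.
\<close>

definition closed_quadrant :: "(real \<times> real) set" where
  "closed_quadrant = {(u, v). 0 \<le> u \<and> 0 \<le> v}"

definition H1 :: "(real \<times> real \<Rightarrow> real) \<Rightarrow> (real \<times> real \<Rightarrow> real) \<Rightarrow> real \<Rightarrow> real \<Rightarrow> bool" where
  "H1 f g us vs \<longleftrightarrow> 0 < us \<and> 0 < vs \<and>
     (\<forall>u v. 0 < u \<and> 0 < v \<longrightarrow> (f (u, v) = 0 \<and> g (u, v) = 0 \<longleftrightarrow> u = us \<and> v = vs))"

definition H2 :: "(real \<times> real \<Rightarrow> real) \<Rightarrow> (real \<times> real \<Rightarrow> real) \<Rightarrow>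
    real \<Rightarrow> real \<Rightarrow> real \<Rightarrow> real \<Rightarrow> bool" where
  "H2 f g u1 v1 u2 v2 \<longleftrightarrow> 0 < u1 \<and> 0 < v1 \<and> 0 < u2 \<and> 0 < v2 \<and>
     (\<forall>u>0. f (u, 0) = 0 \<longleftrightarrow> u = u1) \<and>
     (\<forall>v>0. f (0, v) = 0 \<longleftrightarrow> v = v1) \<and>
     (\<forall>u>0. g (u, 0) = 0 \<longleftrightarrow> u = u2) \<and>
     (\<forall>v>0. g (0, v) = 0 \<longleftrightarrow> v = v2)"

text \<open>
  ``Sufficiently large'' (``sufficiently small'') means that both coordinates exceed
  (stay below) a common threshold.
\<close>

definition H3 :: "(real \<times> real \<Rightarrow> real) \<Rightarrow> (real \<times> real \<Rightarrow> real) \<Rightarrow> bool" where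
  "H3 f g \<longleftrightarrow>
     (\<exists>M>0. \<forall>u v. M < u \<and> M < v \<longrightarrow> f (u, v) < 0 \<and> g (u, v) < 0) \<and>
     (\<exists>\<delta>>0. \<forall>u v. 0 < u \<and> u < \<delta> \<and> 0 < v \<and> v < \<delta> \<longrightarrow> 0 < f (u, v) \<and> 0 < g (u, v))"

definition zero_curve :: "(real \<times> real \<Rightarrow> real) \<Rightarrow> (real \<times> real) set" where
  "zero_curve f = {(u, v). f (u, v) = 0 \<and> 0 \<le> u \<and> 0 \<le> v}"

definition region :: "real \<Rightarrow> real \<Rightarrow> real \<Rightarrow> real \<Rightarrow> (real \<times> real) set" where
  "region ul ub vl vb =
     {(u, v). 0 \<le> u \<and> 0 \<le> v \<and> u / ul + v / vl \<ge> 1 \<and> u / ub + v / vb \<le> 1}"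

definition H4 :: "(real \<times> real \<Rightarrow> real) \<Rightarrow> (real \<times> real \<Rightarrow> real) \<Rightarrow>
    real \<Rightarrow> real \<Rightarrow> real \<Rightarrow> real \<Rightarrow> bool" where
  "H4 f g ul ub vl vb \<longleftrightarrow> 0 < ul \<and> ul < ub \<and> 0 < vl \<and> vl < vb \<and>
     zero_curve f \<subseteq> region ul ub vl vb \<and> zero_curve g \<subseteq> region ul ub vl vb"

definition twice_differentiable :: "(real \<Rightarrow> real) \<Rightarrow> bool" where
  "twice_differentiable w \<longleftrightarrow> (\<forall>x. w differentiable (at x) \<and> deriv w differentiable (at x))"

definition positive_bvp_solution :: "real \<Rightarrow> real \<Rightarrow> real \<Rightarrow>
    (real \<times> real \<Rightarrow> real) \<Rightarrow> (real \<times> real \<Rightarrow> real) \<Rightarrow> real \<times> real \<Rightarrow> real \<times> real \<Rightarrow>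
    (real \<Rightarrow> real) \<Rightarrow> (real \<Rightarrow> real) \<Rightarrow> bool" where
  "positive_bvp_solution d1 d2 \<theta> f g em ep u v \<longleftrightarrow>
     twice_differentiable u \<and> twice_differentiable v \<and>
     (\<forall>x. 0 < u x \<and> 0 < v x) \<and>
     (\<forall>x. d1 * deriv (deriv u) x + \<theta> * deriv u x + u x * f (u x, v x) = 0) \<and>
     (\<forall>x. d2 * deriv (deriv v) x + \<theta> * deriv v x + v x * g (u x, v x) = 0) \<and>
     ((\<lambda>x. (u x, v x)) \<longlongrightarrow> em) at_bot \<and>
     ((\<lambda>x. (u x, v x)) \<longlongrightarrow> ep) at_top"

definition chi :: "real \<times> real \<Rightarrow> real \<times> real \<Rightarrow> real" where
  "chi em ep = (if em \<noteq> (0, 0) \<and> ep \<noteq> (0, 0) then 1 else 0)"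

end

theory Submission
  imports Defs
begin

text \<open>
  Put \<open>U = \<alpha> u\<close>, \<open>V = \<beta> v\<close>, \<open>p = U + V\<close>, \<open>q = d\<^sub>1 U + d\<^sub>2 V\<close>. Below a level \<open>m\<close> at which \<open>f\<close> and \<open>g\<close>
  are positive, both \<open>exp (\<theta> x / d\<^sub>1) U'\<close> and \<open>exp (\<theta> x / d\<^sub>2) V'\<close> decrease. If \<open>q\<close> had an interior
  minimum on a component \<open>(a, b)\<close> of \<open>{p < m}\<close>, this would force \<open>U'\<close> and \<open>V'\<close> to have constant
  opposite signs on \<open>[a, b]\<close>. Depending on the sign of \<open>\<theta> (1/d\<^sub>1 - 1/d\<^sub>2)\<close>, either \<open>p'\<close> times an
  exponential decreases, contradicting \<open>p'(a) \<le> 0 \<le> p'(b)\<close>, or the decreasing function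
  \<open>q' + \<theta> p\<close> gives a contradiction at \<open>b\<close> or at \<open>a\<close>. Hence on \<open>(a, b)\<close> the function \<open>q\<close> is
  bounded below by its boundary values, which are at least \<open>min d\<^sub>1 d\<^sub>2 * m\<close>. The upper bound is
  the same statement for \<open>-U\<close> and \<open>-V\<close>.
\<close>

section \<open>Endpoint derivative signs and the exponential weight\<close>

lemma deriv_nonpos_at_left_max:
  fixes h :: "real \<Rightarrow> real"
  assumes "(h has_real_derivative l) (at a)" "a < b" "\<And>y. a < y \<Longrightarrow> y < b \<Longrightarrow> h y \<le> h a"
  shows "l \<le> 0"
proof (rule ccontr)
  assume "\<not> l \<le> 0"
  then obtain d where d: "d > 0" "\<And>e. 0 < e \<Longrightarrow> e < d \<Longrightarrow> h a < h (a + e)"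
    using DERIV_pos_inc_right[OF assms(1)] by auto
  define e where "e = min d (b - a) / 2"
  have "0 < e" "e < d" "a + e < b"
    using d(1) assms(2) by (auto simp: e_def min_def field_simps)
  then show False using d(2)[of e] assms(3)[of "a + e"] by force
qed

lemma deriv_nonneg_at_right_max:
  fixes h :: "real \<Rightarrow> real"
  assumes "(h has_real_derivative l) (at b)" "a < b" "\<And>y. a < y \<Longrightarrow> y < b \<Longrightarrow> h y \<le> h b"
  shows "0 \<le> l"
proof (rule ccontr)
  assume "\<not> 0 \<le> l"
  then obtain d where d: "d > 0" "\<And>e. 0 < e \<Longrightarrow> e < d \<Longrightarrow> h b < h (b - e)"
    using DERIV_neg_dec_left[OF assms(1)] by auto
  define e where "e = min d (b - a) / 2"
  have "0 < e" "e < d" "a < b - e"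
    using d(1) assms(2) by (auto simp: e_def min_def field_simps)
  then show False using d(2)[of e] assms(3)[of "b - e"] by force
qed

text \<open>The weight is an integrating factor: times \<open>exp (\<theta> * x / d) / d\<close>,
  the expression \<open>d * W'' + \<theta> * W'\<close> is an exact derivative. Its sign is needed
  only inside the interval, since it may fail at the ends of a component of \<open>{p < m}\<close>;
  continuity extends the monotonicity to the closed interval.\<close>

lemma exp_weighted_deriv_decreasing:
  fixes W W' W'' :: "real \<Rightarrow> real"
  assumes "0 < d" and W': "\<And>x. (W' has_real_derivative W'' x) (at x)"
    and neg: "\<And>x. a < x \<Longrightarrow> x < b \<Longrightarrow> d * W'' x + \<theta> * W' x < 0"
    and "a \<le> s" "s < t" "t \<le> b"
  shows "exp (\<theta> * t / d) * W' t < exp (\<theta> * s / d) * W' s"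
proof (rule DERIV_neg_imp_decreasing_open[OF \<open>s < t\<close>])
  fix x assume x: "s < x" "x < t"
  have D: "((\<lambda>x. exp (\<theta> * x / d) * W' x) has_real_derivative
      exp (\<theta> * x / d) / d * (d * W'' x + \<theta> * W' x)) (at x)"
    using \<open>0 < d\<close> by (auto intro!: derivative_eq_intros W' simp: field_simps)
  moreover have "exp (\<theta> * x / d) / d * (d * W'' x + \<theta> * W' x) < 0"
    using neg[of x] x assms by (intro mult_pos_neg) auto
  ultimately show "\<exists>y. ((\<lambda>x. exp (\<theta> * x / d) * W' x) has_real_derivative y) (at x) \<and> y < 0"
    by blast
next
  show "continuous_on {s..t} (\<lambda>x. exp (\<theta> * x / d) * W' x)"
    using W' \<open>0 < d\<close> DERIV_isCont
    by (intro continuous_at_imp_continuous_on ballI continuous_intros) blast+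
qed

section \<open>Minimum principle for \<open>q = d1 * U + d2 * V\<close>\<close>

text \<open>The condition \<open>U' x \<le> 0\<close> only fixes which of the two functions
  decreases; the other case follows by exchanging \<open>(d1, U)\<close> with
  \<open>(d2, V)\<close>. No sign of \<open>U\<close> or \<open>V\<close> is assumed, so the result
  can also be applied to their negatives.\<close>

lemma no_interior_critical_point:
  fixes U V U' V' U'' V'' :: "real \<Rightarrow> real" and d1 d2 \<theta> a b x :: real
  assumes d: "0 < d1" "0 < d2"
    and U: "\<And>x. (U has_real_derivative U' x) (at x)" "\<And>x. (U' has_real_derivative U'' x) (at x)"
    and V: "\<And>x. (V has_real_derivative V' x) (at x)" "\<And>x. (V' has_real_derivative V'' x) (at x)"
    and negU: "\<And>x. a < x \<Longrightarrow> x < b \<Longrightarrow> d1 * U'' x + \<theta> * U' x < 0"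
    and negV: "\<And>x. a < x \<Longrightarrow> x < b \<Longrightarrow> d2 * V'' x + \<theta> * V' x < 0"
    and pa: "\<And>y. a < y \<Longrightarrow> y < b \<Longrightarrow> U y + V y < U a + V a"
    and pb: "\<And>y. a < y \<Longrightarrow> y < b \<Longrightarrow> U y + V y < U b + V b"
    and x: "a < x" "x < b"
    and crit: "d1 * U' x + d2 * V' x = 0" and sgn: "U' x \<le> 0"
  shows False
proof -
  note dp = DERIV_add[OF U(1) V(1)]
  have p'a: "U' a + V' a \<le> 0"
    by (rule deriv_nonpos_at_left_max[OF dp, of a b]) (use pa x in force)+
  have p'b: "0 \<le> U' b + V' b"
    by (rule deriv_nonneg_at_right_max[OF dp, of a b]) (use pb x in force)+
  have EU: "exp (\<theta> * t / d1) * U' t < exp (\<theta> * s / d1) * U' s" if "a \<le> s" "s < t" "t \<le> b" for s t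
    using exp_weighted_deriv_decreasing[of d1 U' U'' a b \<theta> s t] d U(2) negU that by blast
  have EV: "exp (\<theta> * t / d2) * V' t < exp (\<theta> * s / d2) * V' s" if "a \<le> s" "s < t" "t \<le> b" for s t
    using exp_weighted_deriv_decreasing[of d2 V' V'' a b \<theta> s t] d V(2) negV that by blast
  \<comment> \<open>The weights are positive, so the strictly decreasing weighted derivatives allow
    only a sign change from plus to minus: nonpositivity spreads to the right, nonnegativity to the
    left.\<close>
  have Uneg: "U' t < 0" if "s < t" "a \<le> s" "t \<le> b" "U' s \<le> 0" for s t
    using EU[of s t] that
    by (smt (verit) exp_gt_zero mult_nonneg_nonpos mult_nonneg_nonneg)
  have Vpos: "0 < V' s" if "s < t" "a \<le> s" "t \<le> b" "0 \<le> V' t" for s t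
    using EV[of s t] that
    by (smt (verit) exp_gt_zero mult_nonneg_nonpos mult_nonneg_nonneg)
  \<comment> \<open>The signs spread in a loop: from \<open>x\<close> right to \<open>b\<close>,
    there over to \<open>V'\<close> by \<open>p'b\<close>, left through \<open>[a, b]\<close> to
    \<open>a\<close>, there back to \<open>U'\<close> by \<open>p'a\<close>, and right
    again.\<close>
  have "U' b < 0" using Uneg[of x b] x sgn by simp
  then have V'b: "0 < V' b" using p'b by simp
  then have Vall: "0 < V' y" if "a \<le> y" "y \<le> b" for y
    using Vpos[of y b] that by (cases "y = b") auto
  have "U' a < 0" using p'a Vall[of a] x by simp
  then have Uall: "U' y < 0" if "a \<le> y" "y \<le> b" for y
    using Uneg[of a y] that by (cases "y = a") auto
  show False
  proof (cases "\<theta> * (1 / d1 - 1 / d2) \<le> 0")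
    case True
    \<comment> \<open>\<open>exp (c * y)\<close> converts the weight belonging to \<open>d2\<close>
      into the one belonging to \<open>d1\<close>; it does not increase because
      \<open>c \<le> 0\<close> in this case.\<close>
    define c where "c = \<theta> * (1 / d1 - 1 / d2)"
    have split: "exp (\<theta> * y / d1) = exp (c * y) * exp (\<theta> * y / d2)" for y
      unfolding exp_add[symmetric] c_def by (simp add: algebra_simps diff_divide_distrib)
    have dec: "exp (\<theta> * t / d1) * (U' t + V' t) < exp (\<theta> * a / d1) * (U' a + V' a)"
      if "a < t" "t \<le> b" for t
    proof -
      \<comment> \<open>A product of two nonincreasing factors is nonincreasing here because both
        are nonnegative, which is where \<open>V' > 0\<close> enters.\<close>
      have "exp (c * t) * (exp (\<theta> * t / d2) * V' t) \<le> exp (c * a) * (exp (\<theta> * a / d2) * V' a)"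
      proof (rule mult_mono)
        show "exp (c * t) \<le> exp (c * a)"
          using True that by (simp add: c_def mult_left_mono_neg)
        show "exp (\<theta> * t / d2) * V' t \<le> exp (\<theta> * a / d2) * V' a"
          using EV[of a t] that by simp
        show "0 \<le> exp (\<theta> * t / d2) * V' t" using Vall[of t] that by simp
      qed simp
      then have "exp (\<theta> * t / d1) * V' t \<le> exp (\<theta> * a / d1) * V' a"
        by (simp add: split mult.assoc)
      then show ?thesis using EU[of a t] that by (simp add: algebra_simps)
    qed
    have "exp (\<theta> * a / d1) * (U' a + V' a) \<le> 0"
      using p'a by (simp add: mult_nonneg_nonpos)
    moreover have "0 \<le> exp (\<theta> * b / d1) * (U' b + V' b)" using p'b by simp
    ultimately show False using dec[of b] x by linarith
  next
    case False
    \<comment> \<open>The derivative of \<open>\<Phi>\<close> is the sum of the two expressions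
      assumed negative. At the critical point \<open>x\<close> the value of \<open>\<Phi>\<close> is
      just \<open>\<theta> * (U x + V x)\<close>.\<close>
    define \<Phi> where "\<Phi> y = d1 * U' y + d2 * V' y + \<theta> * (U y + V y)" for y
    have dec: "\<Phi> t < \<Phi> s" if "a \<le> s" "s < t" "t \<le> b" for s t
    proof (rule DERIV_neg_imp_decreasing_open[OF \<open>s < t\<close>])
      fix y assume y: "s < y" "y < t"
      have "(\<Phi> has_real_derivative d1 * U'' y + d2 * V'' y + \<theta> * (U' y + V' y)) (at y)"
        unfolding \<Phi>_def by (auto intro!: derivative_eq_intros U V)
      moreover have "d1 * U'' y + d2 * V'' y + \<theta> * (U' y + V' y) < 0"
        using negU[of y] negV[of y] y that by (simp add: algebra_simps)
      ultimately show "\<exists>l. (\<Phi> has_real_derivative l) (at y) \<and> l < 0" by blast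
    next
      show "continuous_on {s..t} \<Phi>"
        unfolding \<Phi>_def using U V DERIV_isCont
        by (intro continuous_at_imp_continuous_on ballI continuous_intros) blast+
    qed
    consider "0 < \<theta>" "d1 < d2" | "\<theta> < 0" "d2 < d1"
      using False d by (auto simp: not_le zero_less_mult_iff divide_less_cancel divide_simps)
    then show False
    proof cases
      case 1
      \<comment> \<open>Since \<open>V' b > 0\<close>, replacing \<open>d1\<close> by the larger
        \<open>d2\<close> in front of it gives \<open>q'(b) \<ge> 0\<close>. Hence
        \<open>\<Phi> b\<close> exceeds \<open>\<Phi> x\<close>, although
        \<open>x < b\<close>.\<close>
      have "0 \<le> d1 * (U' b + V' b)" using d p'b by simp
      also have "\<dots> \<le> d1 * U' b + d2 * V' b" using 1 V'b by (simp add: algebra_simps)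
      finally have "\<theta> * (U b + V b) \<le> \<Phi> b" by (simp add: \<Phi>_def)
      moreover have "\<theta> * (U x + V x) < \<theta> * (U b + V b)" using pb[OF x] 1 by simp
      ultimately show False using dec[of x b] x crit by (simp add: \<Phi>_def)
    next
      case 2
      \<comment> \<open>The mirror image at \<open>a\<close>: now \<open>d2 < d1\<close> gives
        \<open>q'(a) \<le> 0\<close>, and the negative \<open>\<theta>\<close> reverses the
        comparison of \<open>p(a)\<close> with \<open>p(x)\<close>.\<close>
      have "d1 * U' a + d2 * V' a \<le> d1 * (U' a + V' a)"
        using 2 Vall[of a] x by (simp add: algebra_simps)
      also have "\<dots> \<le> 0" using d p'a by (simp add: mult_nonneg_nonpos)
      finally have "\<Phi> a \<le> \<theta> * (U a + V a)" by (simp add: \<Phi>_def)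
      moreover have "\<theta> * (U a + V a) < \<theta> * (U x + V x)" using pa[OF x] 2 by simp
      ultimately show False using dec[of a x] x crit by (simp add: \<Phi>_def)
    qed
  qed
qed

text \<open>A minimum of \<open>q\<close> over the compact interval exists, and inside the interval
  it would be one of the critical points just excluded.\<close>

lemma weighted_sum_ge_boundary:
  fixes U V U' V' U'' V'' :: "real \<Rightarrow> real" and d1 d2 \<theta> a b x :: real
  assumes d: "0 < d1" "0 < d2"
    and U: "\<And>x. (U has_real_derivative U' x) (at x)" "\<And>x. (U' has_real_derivative U'' x) (at x)"
    and V: "\<And>x. (V has_real_derivative V' x) (at x)" "\<And>x. (V' has_real_derivative V'' x) (at x)"
    and negU: "\<And>x. a < x \<Longrightarrow> x < b \<Longrightarrow> d1 * U'' x + \<theta> * U' x < 0"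
    and negV: "\<And>x. a < x \<Longrightarrow> x < b \<Longrightarrow> d2 * V'' x + \<theta> * V' x < 0"
    and pa: "\<And>y. a < y \<Longrightarrow> y < b \<Longrightarrow> U y + V y < U a + V a"
    and pb: "\<And>y. a < y \<Longrightarrow> y < b \<Longrightarrow> U y + V y < U b + V b"
    and x: "a \<le> x" "x \<le> b"
  shows "min (d1 * U a + d2 * V a) (d1 * U b + d2 * V b) \<le> d1 * U x + d2 * V x"
proof -
  define q where "q y = d1 * U y + d2 * V y" for y
  have dq: "(q has_real_derivative d1 * U' y + d2 * V' y) (at y)" for y
    unfolding q_def by (auto intro!: derivative_eq_intros U V)
  have "continuous_on {a..b} q"
    using dq DERIV_isCont by (blast intro: continuous_at_imp_continuous_on)
  then obtain z where z: "z \<in> {a..b}" "\<And>y. y \<in> {a..b} \<Longrightarrow> q z \<le> q y"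
    using continuous_attains_inf[of "{a..b}" q] x by auto
  have "z = a \<or> z = b"
  proof (rule ccontr)
    assume "\<not> (z = a \<or> z = b)"
    then have z': "a < z" "z < b" using z(1) by auto
    have crit: "d1 * U' z + d2 * V' z = 0"
    proof (rule DERIV_local_min[OF dq])
      show "0 < min (z - a) (b - z)" using z' by simp
      show "\<forall>y. \<bar>z - y\<bar> < min (z - a) (b - z) \<longrightarrow> q z \<le> q y"
        by (intro allI impI z(2)) auto
    qed
    show False
    proof (cases "U' z \<le> 0")
      case True
      show False
        by (rule no_interior_critical_point[OF d U V negU negV pa pb z' crit True])
    next
      case False
      \<comment> \<open>At a critical point \<open>U'\<close> and \<open>V'\<close> cannot both be
        positive, so exchanging the two functions restores the required sign.\<close>
      have "V' z \<le> 0"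
        using crit False d by (smt (verit) mult_pos_pos)
      moreover have "d2 * V' z + d1 * U' z = 0" using crit by simp
      ultimately show False
        using no_interior_critical_point[OF d(2,1) V U negV negU _ _ z'] pa pb
        by (simp add: add.commute)
    qed
  qed
  then show ?thesis using z(2)[of x] x by (auto simp: q_def)
qed

text \<open>The strict inequalities near both infinities make every component of
  \<open>{p < m}\<close> bounded, so the estimate on an interval applies. The bound \<open>K\<close>
  is left abstract to serve both \<open>min d1 d2 * m'\<close> and, after a change of sign,
  \<open>- (max d1 d2 * M')\<close>.\<close>

lemma weighted_sum_ge_strict:
  fixes U V U' V' U'' V'' :: "real \<Rightarrow> real" and d1 d2 \<theta> m K x :: real
  assumes d: "0 < d1" "0 < d2"
    and U: "\<And>x. (U has_real_derivative U' x) (at x)" "\<And>x. (U' has_real_derivative U'' x) (at x)"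
    and V: "\<And>x. (V has_real_derivative V' x) (at x)" "\<And>x. (V' has_real_derivative V'' x) (at x)"
    and negU: "\<And>x. U x + V x < m \<Longrightarrow> d1 * U'' x + \<theta> * U' x < 0"
    and negV: "\<And>x. U x + V x < m \<Longrightarrow> d2 * V'' x + \<theta> * V' x < 0"
    and top: "\<forall>\<^sub>F x in at_top. m < U x + V x"
    and bot: "\<forall>\<^sub>F x in at_bot. m < U x + V x"
    and K: "\<And>x. m \<le> U x + V x \<Longrightarrow> K \<le> d1 * U x + d2 * V x"
  shows "K \<le> d1 * U x + d2 * V x"
proof (cases "m \<le> U x + V x")
  case True
  then show ?thesis by (rule K)
next
  case False
  define p where "p y = U y + V y" for y
  have cont: "continuous_on S p" for S
    unfolding p_def using U(1) V(1) DERIV_isCont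
    by (intro continuous_at_imp_continuous_on ballI continuous_intros) blast+
  have px: "p x < m" using False by (simp add: p_def)
  obtain A where A: "\<And>y. y \<le> A \<Longrightarrow> m < p y"
    using bot unfolding eventually_at_bot_linorder p_def by blast
  obtain B where B: "\<And>y. B \<le> y \<Longrightarrow> m < p y"
    using top unfolding eventually_at_top_linorder p_def by blast
  have "A < x" "x < B" using A[of x] B[of x] px by force+
  \<comment> \<open>The largest point of \<open>L\<close> and the smallest point of \<open>R\<close>
    are the ends of the component of \<open>{p < m}\<close> that contains \<open>x\<close>.\<close>
  define L where "L = {A..x} \<inter> p -` {m..}"
  define R where "R = {x..B} \<inter> p -` {m..}"
  have cl: "closed (L)" "closed R"
    unfolding L_def R_def by (intro continuous_closed_preimage cont; simp)+
  have "compact L" unfolding compact_eq_bounded_closed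
    using cl(1) bounded_subset[OF bounded_closed_interval, of L A x] by (auto simp: L_def)
  moreover have "A \<in> L" using A[of A] \<open>A < x\<close> by (auto simp: L_def)
  ultimately obtain a where a: "a \<in> L" "\<And>y. y \<in> L \<Longrightarrow> y \<le> a"
    using compact_attains_sup[of L] by blast
  have "compact R" unfolding compact_eq_bounded_closed
    using cl(2) bounded_subset[OF bounded_closed_interval, of R x B] by (auto simp: R_def)
  moreover have "B \<in> R" using B[of B] \<open>x < B\<close> by (auto simp: R_def)
  ultimately obtain b where b: "b \<in> R" "\<And>y. y \<in> R \<Longrightarrow> b \<le> y"
    using compact_attains_inf[of R] by blast
  have ab: "m \<le> p a" "m \<le> p b" "a \<le> x" "x \<le> b" using a(1) b(1) by (auto simp: L_def R_def)
  have below: "p y < m" if "a < y" "y < b" for y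
    using a(1) b(1) a(2)[of y] b(2)[of y] that by (force simp: L_def R_def)
  have "min (d1 * U a + d2 * V a) (d1 * U b + d2 * V b) \<le> d1 * U x + d2 * V x"
    by (rule weighted_sum_ge_boundary[OF d U V, where \<theta> = \<theta>])
      (use below ab negU negV in \<open>force simp: p_def\<close>)+
  then show ?thesis using K[of a] K[of b] ab by (auto simp: p_def min_def split: if_splits)
qed

section \<open>Signs of the nonlinearities outside the region\<close>

lemma pos_of_no_zero_on_interval:
  fixes h :: "real \<Rightarrow> real"
  assumes "continuous_on {s..t} h" "s \<le> t" "\<And>y. y \<in> {s..t} \<Longrightarrow> h y \<noteq> 0"
  shows "0 < h s \<longleftrightarrow> 0 < h t"
  using IVT'[of h s 0 t] IVT2'[of h t 0 s] assms
  by (metis atLeastAtMost_iff less_eq_real_def linorder_not_less)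

lemma continuous_on_ray:
  assumes "continuous_on closed_quadrant h" "0 < u" "0 < v" "0 \<le> s"
  shows "continuous_on {s..t} (\<lambda>r. h (r * u, r * v) :: real)"
  by (rule continuous_on_compose2[OF assms(1)])
    (use assms in \<open>auto intro!: continuous_intros simp: closed_quadrant_def\<close>)

text \<open>Shrinking \<open>(u, v)\<close> towards the origin keeps it below the lower line, hence
  off the zero curve, until it reaches the points near the origin where \<open>h\<close> is
  positive. The intermediate value theorem carries the sign back.\<close>

lemma pos_below_zero_curve:
  fixes h :: "real \<times> real \<Rightarrow> real"
  assumes cont: "continuous_on closed_quadrant h" and "0 < \<delta>"
    and small: "\<And>u v. 0 < u \<Longrightarrow> u < \<delta> \<Longrightarrow> 0 < v \<Longrightarrow> v < \<delta> \<Longrightarrow> 0 < h (u, v)"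
    and zc: "zero_curve h \<subseteq> region ul ub vl vb" and "0 < ul" "0 < vl"
    and uv: "0 < u" "0 < v" "u / ul + v / vl < 1"
  shows "0 < h (u, v)"
proof -
  \<comment> \<open>With this scale both coordinates are at most \<open>\<delta> / 2\<close>, and
    they remain positive.\<close>
  define s where "s = min 1 (\<delta> / (2 * max u v))"
  have s: "0 < s" "s \<le> 1" using uv \<open>0 < \<delta>\<close> by (auto simp: s_def)
  have "s * max u v \<le> \<delta> / (2 * max u v) * max u v"
    using uv by (intro mult_right_mono) (auto simp: s_def)
  also have "\<dots> < \<delta>" using uv \<open>0 < \<delta>\<close> by (auto simp: max_def)
  finally have "s * max u v < \<delta>" .
  moreover have "s * u \<le> s * max u v" "s * v \<le> s * max u v" using s by auto
  ultimately have "s * u < \<delta>" "s * v < \<delta>" by linarith+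
  then have "0 < h (s * u, s * v)" using s uv by (intro small) auto
  moreover have "h (r * u, r * v) \<noteq> 0" if "r \<in> {s..1}" for r
  proof
    assume "h (r * u, r * v) = 0"
    then have "(r * u, r * v) \<in> zero_curve h" using that s uv by (auto simp: zero_curve_def)
    then have "1 \<le> r * (u / ul + v / vl)" using zc by (auto simp: region_def algebra_simps)
    also have "\<dots> \<le> 1 * (u / ul + v / vl)"
      using that assms by (intro mult_right_mono add_nonneg_nonneg) auto
    finally show False using uv by simp
  qed
  ultimately show ?thesis
    using pos_of_no_zero_on_interval[OF continuous_on_ray[OF cont uv(1,2)], of s 1] s by simp
qed

text \<open>The same argument along the outward ray, which stays above the upper line and ends where
  \<open>h\<close> is known to be negative.\<close>

lemma neg_above_zero_curve:
  fixes h :: "real \<times> real \<Rightarrow> real"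
  assumes cont: "continuous_on closed_quadrant h" and "0 < M"
    and large: "\<And>u v. M < u \<Longrightarrow> M < v \<Longrightarrow> h (u, v) < 0"
    and zc: "zero_curve h \<subseteq> region ul ub vl vb" and "0 < ub" "0 < vb"
    and uv: "0 < u" "0 < v" "1 < u / ub + v / vb"
  shows "h (u, v) < 0"
proof -
  \<comment> \<open>With this scale both coordinates are at least \<open>2 * M\<close>.\<close>
  define t where "t = max 1 (2 * M / min u v)"
  have t: "1 \<le> t" by (auto simp: t_def)
  have "M < 2 * M / min u v * min u v" using uv \<open>0 < M\<close> by (auto simp: min_def)
  also have "\<dots> \<le> t * min u v"
    using uv by (intro mult_right_mono) (auto simp: t_def)
  finally have "M < t * min u v" .
  moreover have "t * min u v \<le> t * u" "t * min u v \<le> t * v" using t by auto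
  ultimately have "M < t * u" "M < t * v" by linarith+
  then have "h (t * u, t * v) < 0" by (intro large)
  moreover have nz: "h (r * u, r * v) \<noteq> 0" if "r \<in> {1..t}" for r
  proof
    assume "h (r * u, r * v) = 0"
    then have "(r * u, r * v) \<in> zero_curve h" using that t uv by (auto simp: zero_curve_def)
    then have "r * (u / ub + v / vb) \<le> 1" using zc by (auto simp: region_def algebra_simps)
    moreover have "1 * (u / ub + v / vb) \<le> r * (u / ub + v / vb)"
      using that assms by (intro mult_right_mono add_nonneg_nonneg) auto
    ultimately have "1 * (u / ub + v / vb) \<le> 1" by (rule order_trans[rotated])
    then show False using uv(3) by simp
  qed
  ultimately have "\<not> 0 < h (u, v)"
    using pos_of_no_zero_on_interval[OF continuous_on_ray[OF cont uv(1,2)], of 1 t] t by simp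
  then show ?thesis using nz[of 1] t by force
qed

section \<open>Comparing levels of weighted sums\<close>

text \<open>Used in contrapositive form: where \<open>\<alpha> * u + \<beta> * v\<close> is below
  the minimum of its values at the two intercepts, \<open>(u, v)\<close> lies below the line. This
  is the origin of the constant \<open>m\<close>.\<close>

lemma min_scaled_le:
  fixes \<alpha> \<beta> a b u v :: real
  assumes "0 < \<alpha>" "0 < \<beta>" "0 < a" "0 < b" "0 \<le> u" "0 \<le> v"
  shows "min (\<alpha> * a) (\<beta> * b) * (u / a + v / b) \<le> \<alpha> * u + \<beta> * v"
proof -
  have "min (\<alpha> * a) (\<beta> * b) * (u / a) \<le> \<alpha> * a * (u / a)"
    and "min (\<alpha> * a) (\<beta> * b) * (v / b) \<le> \<beta> * b * (v / b)"
    using assms by (intro mult_right_mono; simp)+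
  then show ?thesis using assms by (simp add: distrib_left)
qed

lemma le_max_scaled:
  fixes \<alpha> \<beta> a b u v :: real
  assumes "0 < \<alpha>" "0 < \<beta>" "0 < a" "0 < b" "0 \<le> u" "0 \<le> v"
  shows "\<alpha> * u + \<beta> * v \<le> max (\<alpha> * a) (\<beta> * b) * (u / a + v / b)"
proof -
  have "\<alpha> * a * (u / a) \<le> max (\<alpha> * a) (\<beta> * b) * (u / a)"
    and "\<beta> * b * (v / b) \<le> max (\<alpha> * a) (\<beta> * b) * (v / b)"
    using assms by (intro mult_right_mono; simp)+
  then show ?thesis using assms by (simp add: distrib_left)
qed

text \<open>Comparing \<open>q\<close> with \<open>p\<close>, here and in the companion upper
  estimate, costs one factor each way; together they give the quotient of \<open>min d1 d2\<close>
  and \<open>max d1 d2\<close> in the bounds.\<close>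

lemma min_weight_le:
  fixes a b d1 d2 :: real
  assumes "0 \<le> a" "0 \<le> b"
  shows "min d1 d2 * (a + b) \<le> d1 * a + d2 * b"
  using mult_right_mono[of "min d1 d2" d1 a] mult_right_mono[of "min d1 d2" d2 b] assms
  by (simp add: distrib_left)

lemma le_max_weight:
  fixes a b d1 d2 :: real
  assumes "0 \<le> a" "0 \<le> b"
  shows "d1 * a + d2 * b \<le> max d1 d2 * (a + b)"
  using mult_right_mono[of d1 "max d1 d2" a] mult_right_mono[of d2 "max d1 d2" b] assms
  by (simp add: distrib_left)

section \<open>Lower and upper bounds for \<open>\<alpha> * u x + \<beta> * v x\<close>\<close>

theorem theorem1p2:
  fixes d1 d2 \<theta> :: real
    and f g :: "real \<times> real \<Rightarrow> real"
    and us vs u1 v1 u2 v2 ul ub vl vb :: real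
    and em ep :: "real \<times> real"
    and u v :: "real \<Rightarrow> real"
    and \<alpha> \<beta> :: real
  assumes "0 < d1" and "0 < d2"
    and "continuous_on closed_quadrant f" and "continuous_on closed_quadrant g"
    and "H1 f g us vs"
    and "H2 f g u1 v1 u2 v2"
    and "H3 f g"
    and "H4 f g ul ub vl vb"
    and "em \<in> {(0, 0), (u1, 0), (0, v2), (us, vs)}"
    and "ep \<in> {(0, 0), (u1, 0), (0, v2), (us, vs)}"
    and "positive_bvp_solution d1 d2 \<theta> f g em ep u v"
    and "0 < \<alpha>" and "0 < \<beta>"
  shows "\<forall>x. min (\<alpha> * ul) (\<beta> * vl) * (min d1 d2 / max d1 d2) * chi em ep \<le> \<alpha> * u x + \<beta> * v x
           \<and> \<alpha> * u x + \<beta> * v x \<le> max (\<alpha> * ub) (\<beta> * vb) * (max d1 d2 / min d1 d2)"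
proof -
  define U where "U x = \<alpha> * u x" for x
  define V where "V x = \<beta> * v x" for x
  define U' where "U' x = \<alpha> * deriv u x" for x
  define V' where "V' x = \<beta> * deriv v x" for x
  define U'' where "U'' x = \<alpha> * deriv (deriv u) x" for x
  define V'' where "V'' x = \<beta> * deriv (deriv v) x" for x
  define m where "m = min (\<alpha> * ul) (\<beta> * vl)"
  define M where "M = max (\<alpha> * ub) (\<beta> * vb)"
  have sol: "twice_differentiable u" "twice_differentiable v"
    and uv: "0 < u x" "0 < v x"
    and odeu: "d1 * deriv (deriv u) x + \<theta> * deriv u x = - (u x * f (u x, v x))"
    and odev: "d2 * deriv (deriv v) x + \<theta> * deriv v x = - (v x * g (u x, v x))"
    and limm: "((\<lambda>x. (u x, v x)) \<longlongrightarrow> em) at_bot"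
    and limp: "((\<lambda>x. (u x, v x)) \<longlongrightarrow> ep) at_top" for x
    using \<open>positive_bvp_solution d1 d2 \<theta> f g em ep u v\<close>
    by (auto simp: positive_bvp_solution_def eq_neg_iff_add_eq_0)
  have H4: "0 < ul" "ul < ub" "0 < vl" "vl < vb"
    "zero_curve f \<subseteq> region ul ub vl vb" "zero_curve g \<subseteq> region ul ub vl vb"
    using \<open>H4 f g ul ub vl vb\<close> by (auto simp: H4_def)
  then have b: "0 < ub" "0 < vb" by linarith+
  obtain N where N: "N > 0" "\<And>u v. N < u \<Longrightarrow> N < v \<Longrightarrow> f (u, v) < 0"
    "\<And>u v. N < u \<Longrightarrow> N < v \<Longrightarrow> g (u, v) < 0"
    using \<open>H3 f g\<close> unfolding H3_def by blast
  obtain \<delta> where \<delta>: "\<delta> > 0"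
    "\<And>u v. 0 < u \<Longrightarrow> u < \<delta> \<Longrightarrow> 0 < v \<Longrightarrow> v < \<delta> \<Longrightarrow> 0 < f (u, v)"
    "\<And>u v. 0 < u \<Longrightarrow> u < \<delta> \<Longrightarrow> 0 < v \<Longrightarrow> v < \<delta> \<Longrightarrow> 0 < g (u, v)"
    using \<open>H3 f g\<close> unfolding H3_def by blast
  have pos: "0 < f (u x, v x)" "0 < g (u x, v x)" if "U x + V x < m" for x
  proof -
    have "m * (u x / ul + v x / vl) < m * 1"
      using min_scaled_le[of \<alpha> \<beta> ul vl "u x" "v x"] that uv[of x] H4 assms(12,13)
      by (simp add: U_def V_def m_def)
    moreover have "0 < m" using H4 assms(12,13) by (simp add: m_def)
    ultimately have "u x / ul + v x / vl < 1" by (simp only: mult_less_cancel_left_pos)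
    then show "0 < f (u x, v x)" "0 < g (u x, v x)"
      using pos_below_zero_curve[OF assms(3) \<delta>(1,2) H4(5)]
        pos_below_zero_curve[OF assms(4) \<delta>(1,3) H4(6)] H4 uv[of x] by blast+
  qed
  have neg: "f (u x, v x) < 0" "g (u x, v x) < 0" if "M < U x + V x" for x
  proof -
    have "M * 1 < M * (u x / ub + v x / vb)"
      using le_max_scaled[of \<alpha> \<beta> ub vb "u x" "v x"] that uv[of x] b assms(12,13)
      by (simp add: U_def V_def M_def)
    moreover have "0 < M" using b assms(12,13) by (simp add: M_def less_max_iff_disj)
    ultimately have "1 < u x / ub + v x / vb" by (simp only: mult_less_cancel_left_pos)
    then show "f (u x, v x) < 0" "g (u x, v x) < 0"
      using neg_above_zero_curve[OF assms(3) N(1,2) H4(5) b]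
        neg_above_zero_curve[OF assms(4) N(1,3) H4(6) b] uv[of x] by blast+
  qed
  \<comment> \<open>\<open>(u1, 0)\<close> is a zero of \<open>f\<close>, \<open>(0, v2)\<close> a
    zero of \<open>g\<close>, and \<open>(us, vs)\<close> of both, so each lies on a curve contained
    in the region.\<close>
  have ends: "e \<in> region ul ub vl vb" if "e \<in> {(0, 0), (u1, 0), (0, v2), (us, vs)}" "e \<noteq> (0, 0)" for e
  proof -
    have "e \<in> zero_curve f \<or> e \<in> zero_curve g"
      using that \<open>H1 f g us vs\<close> \<open>H2 f g u1 v1 u2 v2\<close>
      by (auto simp: H1_def H2_def zero_curve_def)
    then show ?thesis using H4 by blast
  qed
  have end_lower: "m \<le> \<alpha> * fst e + \<beta> * snd e" if "e \<in> region ul ub vl vb" for e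
  proof -
    have e: "0 \<le> fst e" "0 \<le> snd e" "1 \<le> fst e / ul + snd e / vl"
      using that by (auto simp: region_def)
    have "m * 1 \<le> m * (fst e / ul + snd e / vl)"
      using H4 assms(12,13) e(3) by (intro mult_left_mono) (auto simp: m_def)
    also have "\<dots> \<le> \<alpha> * fst e + \<beta> * snd e"
      using min_scaled_le e H4 assms(12,13) unfolding m_def by blast
    finally show ?thesis by simp
  qed
  have M0: "0 < M" using b assms(12,13) by (simp add: M_def less_max_iff_disj)
  have end_upper: "\<alpha> * fst e + \<beta> * snd e \<le> M"
    if "e \<in> {(0, 0), (u1, 0), (0, v2), (us, vs)}" for e
  proof (cases "e = (0, 0)")
    case True
    then show ?thesis using M0 by simp
  next
    case False
    then have e: "0 \<le> fst e" "0 \<le> snd e" "fst e / ub + snd e / vb \<le> 1"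
      using ends[OF that] by (auto simp: region_def)
    have "\<alpha> * fst e + \<beta> * snd e \<le> M * (fst e / ub + snd e / vb)"
      using le_max_scaled e b assms(12,13) unfolding M_def by blast
    also have "\<dots> \<le> M * 1" using M0 e(3) by (intro mult_left_mono) auto
    finally show ?thesis by simp
  qed
  have lim: "((\<lambda>x. U x + V x) \<longlongrightarrow> \<alpha> * fst e + \<beta> * snd e) F"
    if "((\<lambda>x. (u x, v x)) \<longlongrightarrow> e) F" for e F
    unfolding U_def V_def
    using tendsto_fst[OF that] tendsto_snd[OF that] by (auto intro!: tendsto_intros)
  have D: "(U has_real_derivative U' x) (at x)" "(U' has_real_derivative U'' x) (at x)"
    "(V has_real_derivative V' x) (at x)" "(V' has_real_derivative V'' x) (at x)" for x
    using sol unfolding U_def V_def U'_def V'_def U''_def V''_def twice_differentiable_def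
    by (auto intro!: DERIV_cmult simp: DERIV_deriv_iff_real_differentiable)
  have eqU: "d1 * U'' x + \<theta> * U' x = - (\<alpha> * u x * f (u x, v x))" for x
    using arg_cong[OF odeu, of "(*) \<alpha>" x] by (simp add: U''_def U'_def algebra_simps)
  have eqV: "d2 * V'' x + \<theta> * V' x = - (\<beta> * v x * g (u x, v x))" for x
    using arg_cong[OF odev, of "(*) \<beta>" x] by (simp add: V''_def V'_def algebra_simps)
  have UV: "0 < U x" "0 < V x" for x using uv assms(12,13) by (auto simp: U_def V_def)
  have dmin: "0 < min d1 d2" and dmax: "0 < max d1 d2" using assms(1,2) by auto
  have lower: "m * (min d1 d2 / max d1 d2) * chi em ep \<le> U x + V x" for x
  proof (cases "em \<noteq> (0, 0) \<and> ep \<noteq> (0, 0)")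
    case True
    then have e: "m \<le> \<alpha> * fst em + \<beta> * snd em" "m \<le> \<alpha> * fst ep + \<beta> * snd ep"
      using end_lower ends assms(9,10) by auto
    \<comment> \<open>The limits of \<open>U + V\<close> may equal \<open>m\<close>, while the
      minimum principle wants strict inequalities at infinity. The estimate is proved for every
      \<open>m' < m\<close>, and then \<open>m'\<close> tends to \<open>m\<close>.\<close>
    have step: "min d1 d2 * m' \<le> d1 * U x + d2 * V x" if "m' < m" for m'
    proof (rule weighted_sum_ge_strict[OF assms(1,2) D, where m = m' and \<theta> = \<theta>])
      fix x assume "U x + V x < m'"
      then have "U x + V x < m" using that by simp
      from pos[OF this] show "d1 * U'' x + \<theta> * U' x < 0" "d2 * V'' x + \<theta> * V' x < 0"
        using uv[of x] assms(12,13) by (simp_all add: eqU eqV)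
    next
      show "\<forall>\<^sub>F x in at_top. m' < U x + V x"
        using order_tendstoD(1)[OF lim[OF limp]] that e by simp
      show "\<forall>\<^sub>F x in at_bot. m' < U x + V x"
        using order_tendstoD(1)[OF lim[OF limm]] that e by simp
    next
      fix x assume "m' \<le> U x + V x"
      then have "min d1 d2 * m' \<le> min d1 d2 * (U x + V x)"
        using dmin by (intro mult_left_mono) auto
      also have "\<dots> \<le> d1 * U x + d2 * V x" using UV[of x] by (intro min_weight_le) auto
      finally show "min d1 d2 * m' \<le> d1 * U x + d2 * V x" .
    qed
    have "m \<le> (d1 * U x + d2 * V x) / min d1 d2"
    proof (rule dense_le)
      show "m' \<le> (d1 * U x + d2 * V x) / min d1 d2" if "m' < m" for m'
        using step[OF that] dmin by (simp only: pos_le_divide_eq mult.commute)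
    qed
    then have "m * min d1 d2 \<le> d1 * U x + d2 * V x"
      using dmin by (simp only: pos_le_divide_eq)
    also have "\<dots> \<le> max d1 d2 * (U x + V x)" using UV[of x] by (intro le_max_weight) auto
    finally have "m * min d1 d2 / max d1 d2 \<le> U x + V x"
      using dmax by (simp only: pos_divide_le_eq mult.commute)
    then show ?thesis using True by (simp add: chi_def)
  next
    case False
    \<comment> \<open>When an end state is the origin, \<open>chi\<close> vanishes and positivity is
      all that is claimed.\<close>
    then show ?thesis using UV[of x] by (auto simp: chi_def)
  qed
  have upper: "U x + V x \<le> M * (max d1 d2 / min d1 d2)" for x
  proof -
    have e: "\<alpha> * fst em + \<beta> * snd em \<le> M" "\<alpha> * fst ep + \<beta> * snd ep \<le> M"
      using end_upper assms(9,10) by auto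
    have step: "d1 * U x + d2 * V x \<le> max d1 d2 * M'" if "M < M'" for M'
    proof -
      \<comment> \<open>Negation turns \<open>{p > M'}\<close> into a sublevel set at level
        \<open>- M'\<close>, where negative \<open>f\<close> and \<open>g\<close> provide the
        required inequalities. Again \<open>M'\<close> is strictly above \<open>M\<close> and tends
        to it afterwards.\<close>
      note D' = D[THEN DERIV_minus]
      have "- (max d1 d2 * M') \<le> d1 * - U x + d2 * - V x"
      proof (rule weighted_sum_ge_strict[OF assms(1,2) D', where m = "- M'" and \<theta> = \<theta>])
        fix x assume "- U x + - V x < - M'"
        then have "M < U x + V x" using that by simp
        from neg[OF this] have "0 < d1 * U'' x + \<theta> * U' x" "0 < d2 * V'' x + \<theta> * V' x"
          using uv[of x] assms(12,13) by (simp_all add: eqU eqV mult_pos_neg)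
        then show "d1 * - U'' x + \<theta> * - U' x < 0" "d2 * - V'' x + \<theta> * - V' x < 0"
          by simp_all
      next
        have "\<forall>\<^sub>F x in at_top. U x + V x < M'"
          using order_tendstoD(2)[OF lim[OF limp]] that e by simp
        then show "\<forall>\<^sub>F x in at_top. - M' < - U x + - V x" by eventually_elim simp
        have "\<forall>\<^sub>F x in at_bot. U x + V x < M'"
          using order_tendstoD(2)[OF lim[OF limm]] that e by simp
        then show "\<forall>\<^sub>F x in at_bot. - M' < - U x + - V x" by eventually_elim simp
      next
        fix x assume "- M' \<le> - U x + - V x"
        then have "max d1 d2 * (U x + V x) \<le> max d1 d2 * M'"
          using dmax by (intro mult_left_mono) auto
        moreover have "d1 * U x + d2 * V x \<le> max d1 d2 * (U x + V x)"
          using UV[of x] by (intro le_max_weight) auto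
        ultimately show "- (max d1 d2 * M') \<le> d1 * - U x + d2 * - V x" by simp
      qed
      then show ?thesis by simp
    qed
    have "(d1 * U x + d2 * V x) / max d1 d2 \<le> M"
    proof (rule dense_ge)
      show "(d1 * U x + d2 * V x) / max d1 d2 \<le> M'" if "M < M'" for M'
        using step[OF that] dmax by (simp only: pos_divide_le_eq mult.commute)
    qed
    then have "d1 * U x + d2 * V x \<le> M * max d1 d2"
      using dmax by (simp only: pos_divide_le_eq)
    moreover have "min d1 d2 * (U x + V x) \<le> d1 * U x + d2 * V x"
      using UV[of x] by (intro min_weight_le) auto
    ultimately have "(U x + V x) * min d1 d2 \<le> M * max d1 d2"
      by (simp only: mult.commute)
    then have "U x + V x \<le> M * max d1 d2 / min d1 d2"
      using dmin by (simp only: pos_le_divide_eq)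
    then show ?thesis by simp
  qed
  show ?thesis using lower upper unfolding m_def M_def U_def V_def by blast
qed

end
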